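(* Let $M>0$ and let $f=h+\overline{g}\in\mathcal{P}^0_{\mathcal{H}}(M)$ be given by $f(z)=z+\sum_{n=2}^{\infty}a_nz^n+\overline{\sum_{n=2}^{\infty}b_nz^n}$. Then for $N\ge 2$, $$|f(z)|^2+\sum_{n=N}^{\infty}(|a_n|+|b_n|)|z|^n\le d\left(f(0),\partial f(\mathbb{D})\right)$$ for $|z|=r\le r_N(M)$, where $r_N(M)$ is the smallest root in $(0,1)$ of the equation $$\bigl(r+2M(r+(1-r)\ln(1-r))\bigr)^2-1+2M\left(r-1+(1-r)\ln(1-r)-\sum_{n=2}^{N-1}\frac{r^n}{n(n-1)}+\ln 4\right)=0 .$$ The radius $r_N(M)$ is the best possible.
   Context: $\mathbb{D}=\{z\in\mathbb{C}:|z|<1\}$. $\mathcal{H}_0$ is the class of complex-valued harmonic mappings $f=h+\overline{g}$ in $\mathbb{D}$ with $h,g$ analytic in $\mathbb{D}$, $h(0)=0$, $h'(0)=1$, $g(0)=0$, $g'(0)=0$. For $M>0$, $$\mathcal{P}^0_{\mathcal{H}}(M)=\{f=h+\overline{g}\in\mathcal{H}_0:\ \operatorname{Re}(zh''(z))>-M+|zg''(z)|\ \text{for all } z\in\mathbb{D}\}.$$ $N$ is an integer. $d(f(0),\partial f(\mathbb{D}))$ denotes the Euclidean distance between $f(0)$ and the boundary of $f(\mathbb{D})$, given by $d(f(0),\partial f(\mathbb{D}))=\liminf_{|z|\to1}|f(z)-f(0)|$. Empty sums are $0$. "Best possible" means that the radius cannot be replaced by a larger one for the whole class.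
   Formalization: For M ≥ 1/(2(ln 4 − 1)) the equation has no root in (0,1), so r_N(M) is undefined; existence of the root is claimed only for 2M(ln 4 − 1) < 1, and the inequality and its sharpness whenever r_N(M) exists. *)

theory Defs
  imports "HOL-Analysis.Analysis"
begin

text \<open>
  The open unit disc is \<open>ball 0 1\<close>. Mappings of the disc are total functions on \<^typ>\<open>complex\<close>;
  only their values on the disc matter below.
\<close>

definition harmonic_decomp ::
  "(complex \<Rightarrow> complex) \<Rightarrow> (complex \<Rightarrow> complex) \<Rightarrow> (complex \<Rightarrow> complex) \<Rightarrow> bool"
where
  "harmonic_decomp f h g \<longleftrightarrow>
     h holomorphic_on ball 0 1 \<and> g holomorphic_on ball 0 1 \<and>
     (\<forall>z\<in>ball 0 1. f z = h z + cnj (g z)) \<and>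
     h 0 = 0 \<and> deriv h 0 = 1 \<and> g 0 = 0 \<and> deriv g 0 = 0"

definition class_H0 :: "(complex \<Rightarrow> complex) set" where
  "class_H0 = {f. \<exists>h g. harmonic_decomp f h g}"

text \<open>
  By the normalisation \<open>g 0 = 0\<close>, the two parts \<open>h\<close> and \<open>g\<close> are determined by \<open>f\<close> on the disc,
  so the existential quantifier does not choose between decompositions.
\<close>

definition class_P0H :: "real \<Rightarrow> (complex \<Rightarrow> complex) set" where
  "class_P0H M = {f \<in> class_H0. \<exists>h g. harmonic_decomp f h g \<and>
     (\<forall>z\<in>ball 0 1. Re (z * deriv (deriv h) z) > - M + cmod (z * deriv (deriv g) z))}"

text \<open>Only \<open>a n\<close>, \<open>b n\<close> with \<open>n \<ge> 2\<close> are constrained (and used).\<close>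

definition harmonic_expansion ::
  "(complex \<Rightarrow> complex) \<Rightarrow> (nat \<Rightarrow> complex) \<Rightarrow> (nat \<Rightarrow> complex) \<Rightarrow> bool"
where
  "harmonic_expansion f a b \<longleftrightarrow>
     (\<forall>z\<in>ball 0 1.
        summable (\<lambda>n. a (n + 2) * z ^ (n + 2)) \<and>
        summable (\<lambda>n. b (n + 2) * z ^ (n + 2)) \<and>
        f z = z + (\<Sum>n. a (n + 2) * z ^ (n + 2)) + cnj (\<Sum>n. b (n + 2) * z ^ (n + 2)))"

text \<open>
  The distance from \<open>f 0\<close> to the boundary of the image, in the form
  $\liminf_{|z| \to 1} |f(z) - f(0)|$ with \<open>z\<close> approaching the unit circle from inside the disc.
  For mappings that are not univalent this number can be larger than the distance from
  \<open>f 0\<close> to \<open>frontier (f ` ball 0 1)\<close>. It is an extended real, so no boundedness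
  of \<open>f\<close> has to be presupposed.
\<close>

definition boundary_dist :: "(complex \<Rightarrow> complex) \<Rightarrow> ereal" where
  "boundary_dist f = Liminf (filtercomap cmod (at_left 1)) (\<lambda>z. ereal (cmod (f z - f 0)))"

text \<open>
  The tail series is the one over \<open>n \<ge> N\<close>, with the index shifted. It converges for every \<open>z\<close> in
  the disc, because the power series of an expansion converge absolutely there.
\<close>

definition bohr_ineq ::
  "nat \<Rightarrow> (complex \<Rightarrow> complex) \<Rightarrow> (nat \<Rightarrow> complex) \<Rightarrow> (nat \<Rightarrow> complex) \<Rightarrow> complex \<Rightarrow> bool"
where
  "bohr_ineq N f a b z \<longleftrightarrow>
     ereal ((cmod (f z))\<^sup>2 + (\<Sum>n. (cmod (a (n + N)) + cmod (b (n + N))) * cmod z ^ (n + N)))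
       \<le> boundary_dist f"

definition bohr_eq_lhs :: "real \<Rightarrow> nat \<Rightarrow> real \<Rightarrow> real" where
  "bohr_eq_lhs M N r =
     (r + 2 * M * (r + (1 - r) * ln (1 - r)))\<^sup>2 - 1
     + 2 * M * (r - 1 + (1 - r) * ln (1 - r)
                - (\<Sum>n = 2..<N. r ^ n / (real n * (real n - 1))) + ln 4)"

definition smallest_root_01 :: "(real \<Rightarrow> real) \<Rightarrow> real \<Rightarrow> bool" where
  "smallest_root_01 \<Phi> r \<longleftrightarrow>
     r \<in> {0<..<1} \<and> \<Phi> r = 0 \<and> (\<forall>s\<in>{0<..<1}. \<Phi> s = 0 \<longrightarrow> r \<le> s)"

end

(* If f = h + cnj g is in the class and |e| = 1, then p = 1 + z (h'' + e g'') / M has positive real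
   part and p(0) = 1. Caratheodory's coefficient bound gives |a_n| + |b_n| <= 2M / (n (n - 1)), hence
   the upper bound for |f|; the bound Re p >= (1 - |z|) / (1 + |z|), integrated twice along a ray,
   gives |f(z)| >= r + 2M (r - (1 + r) ln (1 + r)) and hence a boundary distance of at least
   1 + 2M (1 - ln 4). The left-hand side of the equation is strictly increasing and equals
   (upper bound for |f|)^2 + (tail bound) - (lower bound for the distance). All these bounds are
   attained by f(z) = z + 2M (z + (1 - z) Ln (1 - z)): the upper ones on the positive radius, the
   boundary distance along the negative one. *)

theory Submission
  imports Defs "HOL-Complex_Analysis.Complex_Analysis"
begin

section \<open>Caratheodory's inequalities for functions with positive real part\<close>

text \<open>On a circle about 0, dz = 2 pi i z dt. This turns Cauchy's formulas into plain averages
  over \<open>{0..1}\<close>, whose real parts can be estimated from pointwise signs.\<close>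

lemma has_integral_circlepath_param:
  assumes "(f has_contour_integral I) (circlepath 0 r)"
  shows "((\<lambda>t. f (circlepath 0 r t) * circlepath 0 r t) has_integral (I / (2 * pi * \<i>))) {0..1}"
proof -
  have "((\<lambda>t. f (circlepath 0 r t) * vector_derivative (circlepath 0 r) (at t)) has_integral I) {0..1}"
    using assms by (simp add: has_contour_integral)
  from has_integral_mult_right[OF this, of "1 / (2 * pi * \<i>)"]
  show ?thesis
    by (simp add: vector_derivative_circlepath) (simp add: circlepath mult_ac)
qed

text \<open>On the circle of radius \<open>r\<close>, the average of \<open>p\<close> against the
  nonnegative weight 1 + Re w, with w a rotated multiple of z^(-n), has nonnegative real part. That
  average equals 1 - r^n |c| / 2, and r tends to 1.\<close>

lemma caratheodory_coeff_bound:
  assumes hol: "p holomorphic_on ball 0 1" and p0: "p 0 = 1"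
    and pos: "\<And>z. z \<in> ball 0 1 \<Longrightarrow> Re (p z) \<ge> 0" and n: "n > 0"
  shows "cmod ((deriv ^^ n) p 0 / fact n) \<le> 2"
proof -
  define c where "c = (deriv ^^ n) p 0 / fact n"
  have bound: "r ^ n * cmod c \<le> 2" if r: "0 < r" "r < 1" for r :: real
  proof (cases "c = 0")
    case False
    define z where "z = circlepath 0 r"
    \<comment> \<open>The rotation taking \<open>c\<close> to the negative number -|c|, so that
      nonnegativity of the average bounds |c| from above.\<close>
    define u where "u = - cnj (sgn c)"
    have nu: "cmod u = 1" and uc: "u * c = - of_real (cmod c)"
      using False complex_norm_square[of c]
      by (auto simp: u_def norm_sgn norm_divide sgn_eq power2_eq_square field_simps)
    have nz: "cmod (z t) = r" for t
      using r by (simp add: z_def circlepath norm_mult)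
    have z0: "z t \<noteq> 0" for t
      using nz[of t] r by auto
    have sub: "cball 0 r \<subseteq> ball (0::complex) 1"
      using r by auto
    have cont: "continuous_on (cball 0 r) p"
      using hol holomorphic_on_imp_continuous_on holomorphic_on_subset sub by blast
    have hol': "p holomorphic_on ball 0 r"
      using hol holomorphic_on_subset sub ball_subset_cball by (metis order_trans)
    \<comment> \<open>Needed for \<open>k = 0\<close>, the mean value, and for
      \<open>k = n\<close>.\<close>
    have A: "((\<lambda>t. p (z t) / z t ^ k) has_integral ((deriv ^^ k) p 0 / fact k)) {0..1}" for k
      using has_integral_circlepath_param
        [OF Cauchy_has_contour_integral_higher_derivative_circlepath[OF cont hol', of 0 k]] r z0
      by (simp add: z_def[symmetric] field_simps)
    \<comment> \<open>The parametrisation contributes one factor z, so the integrand is p(w)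
      w^(n-1), which is holomorphic because \<open>n > 0\<close>.\<close>
    have B: "((\<lambda>t. p (z t) * z t ^ n) has_integral 0) {0..1}"
    proof -
      have "((\<lambda>w. p w * w ^ (n - 1)) has_contour_integral 0) (circlepath 0 r)"
      proof (rule Cauchy_theorem_convex_simple)
        show "(\<lambda>w. p w * w ^ (n - 1)) holomorphic_on ball 0 1"
          by (intro holomorphic_intros hol)
      qed (use r in \<open>auto simp: path_image_circlepath\<close>)
      from has_integral_circlepath_param[OF this] show ?thesis
        using n by (cases n) (simp_all add: z_def[symmetric] mult_ac)
    qed
    \<comment> \<open>Unimodular on the circle, hence 1 + Re w \<ge> 0. Its conjugate is a multiple
      of z^n, so the weight combines only 1, z^(-n) and z^n, whose averages against \<open>p\<close>
      are given by \<open>A\<close> and \<open>B\<close>.\<close>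
    define w where "w t = u * of_real r ^ n / z t ^ n" for t
    have nw: "cmod (w t) = 1" for t
      using r by (simp add: w_def norm_mult norm_divide norm_power nz nu)
    have cw: "cnj (w t) = cnj u * z t ^ n / of_real r ^ n" for t
    proof -
      have "z t * cnj (z t) = of_real r * of_real r"
        using complex_norm_square[of "z t"] by (simp add: nz power2_eq_square)
      hence "z t ^ n * cnj (z t) ^ n = of_real r ^ n * of_real r ^ n"
        by (simp flip: power_mult_distrib)
      thus ?thesis
        using r z0[of t] by (simp add: w_def field_simps)
    qed
    have I: "((\<lambda>t. p (z t) / z t ^ 0 + (u * of_real r ^ n / 2) * (p (z t) / z t ^ n)
               + (cnj u / (2 * of_real r ^ n)) * (p (z t) * z t ^ n))
            has_integral ((deriv ^^ 0) p 0 / fact 0 + (u * of_real r ^ n / 2) * c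
               + (cnj u / (2 * of_real r ^ n)) * 0)) {0..1}"
      unfolding c_def by (intro has_integral_add has_integral_mult_right A B)
    have eq: "p (z t) / z t ^ 0 + (u * of_real r ^ n / 2) * (p (z t) / z t ^ n)
               + (cnj u / (2 * of_real r ^ n)) * (p (z t) * z t ^ n) =
             p (z t) * of_real (1 + Re (w t))" for t
    proof -
      have "p (z t) * of_real (1 + Re (w t)) = p (z t) * (1 + (w t + cnj (w t)) / 2)"
        by (simp add: complex_add_cnj)
      also have "\<dots> = p (z t) / z t ^ 0 + (u * of_real r ^ n / 2) * (p (z t) / z t ^ n)
               + (cnj u / (2 * of_real r ^ n)) * (p (z t) * z t ^ n)"
        unfolding cw by (simp add: w_def algebra_simps add_divide_distrib)
      finally show ?thesis by simp
    qed
    have val: "(deriv ^^ 0) p 0 / fact 0 + (u * of_real r ^ n / 2) * c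
               + (cnj u / (2 * of_real r ^ n)) * 0 = of_real (1 - r ^ n * cmod c / 2)"
    proof -
      have "(u * of_real r ^ n / 2) * c = of_real r ^ n / 2 * (u * c)" by simp
      thus ?thesis unfolding uc by (simp add: p0)
    qed
    have "((\<lambda>t. Re (p (z t) * of_real (1 + Re (w t)))) has_integral Re (of_real (1 - r ^ n * cmod c / 2))) {0..1}"
      using has_integral_linear[OF I bounded_linear_Re] unfolding eq val by (simp add: o_def)
    moreover have "Re (p (z t) * of_real (1 + Re (w t))) \<ge> 0" for t
    proof -
      have "Re (p (z t)) \<ge> 0" using pos nz r by simp
      moreover have "1 + Re (w t) \<ge> 0" using abs_Re_le_cmod[of "w t"] by (simp add: nw)
      ultimately show ?thesis by simp
    qed
    ultimately have "0 \<le> Re (of_real (1 - r ^ n * cmod c / 2))"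
      by (rule has_integral_nonneg)
    thus ?thesis by simp
  qed simp
  have "((\<lambda>r. r ^ n * cmod c) \<longlongrightarrow> 1 ^ n * cmod c) (at_left (1::real))"
    by (intro tendsto_intros)
  moreover have "eventually (\<lambda>r. r ^ n * cmod c \<le> 2) (at_left (1::real))"
    using eventually_at_left_real[OF zero_less_one] by eventually_elim (auto intro: bound)
  ultimately have "1 ^ n * cmod c \<le> 2"
    by (rule tendsto_upperbound) simp
  thus ?thesis by (simp add: c_def)
qed

text \<open>The Cayley transform of \<open>p\<close> maps the disc into itself and fixes 0. By
  Schwarz, |p - 1| \<le> |z| |p + 1|: a disc whose leftmost point is (1 - |z|) / (1 + |z|).\<close>

lemma caratheodory_Re_ge:
  assumes hol: "p holomorphic_on ball 0 1" and p0: "p 0 = 1"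
    and pos: "\<And>z. z \<in> ball 0 1 \<Longrightarrow> Re (p z) > 0" and z: "cmod z < 1"
  shows "Re (p z) \<ge> (1 - cmod z) / (1 + cmod z)"
proof -
  define \<phi> where "\<phi> w = (p w - 1) / (p w + 1)" for w
  have ne: "p w + 1 \<noteq> 0" if "cmod w < 1" for w
    using pos[of w] that by (auto simp: complex_eq_iff)
  have lt: "cmod (\<phi> w) < 1" if "cmod w < 1" for w
  proof -
    have "(cmod (p w - 1))\<^sup>2 < (cmod (p w + 1))\<^sup>2"
      using pos[of w] that unfolding cmod_power2 by (simp add: power2_eq_square algebra_simps)
    hence "cmod (p w - 1) < cmod (p w + 1)"
      by (rule power2_less_imp_less) simp
    thus ?thesis using ne[OF that] by (simp add: \<phi>_def norm_divide)
  qed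
  have "cmod (\<phi> z) \<le> cmod z"
  proof (rule Schwarz_Lemma)
    show "\<phi> holomorphic_on ball 0 1"
      unfolding \<phi>_def using ne by (intro holomorphic_intros hol) auto
  qed (use lt z p0 in \<open>auto simp: \<phi>_def\<close>)
  hence le: "cmod (p z - 1) \<le> cmod z * cmod (p z + 1)"
    using ne[OF z] by (simp add: \<phi>_def norm_divide divide_simps)
  define r x where "r = cmod z" and "x = Re (p z)"
  have r: "0 \<le> r" "r < 1" and x: "x > 0"
    using z pos[of z] by (auto simp: r_def x_def)
  have "(cmod (p z - 1))\<^sup>2 \<le> (r * cmod (p z + 1))\<^sup>2"
    using le unfolding r_def by (intro power_mono) auto
  hence "(x - 1)\<^sup>2 + (Im (p z))\<^sup>2 \<le> r\<^sup>2 * ((x + 1)\<^sup>2 + (Im (p z))\<^sup>2)"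
    by (simp add: power_mult_distrib cmod_power2 x_def)
  \<comment> \<open>Lets the imaginary parts be dropped from both sides.\<close>
  moreover have "r\<^sup>2 * (Im (p z))\<^sup>2 \<le> 1 * (Im (p z))\<^sup>2"
    using r by (intro mult_right_mono) (auto simp: power_le_one)
  ultimately have "(1 - x)\<^sup>2 \<le> (r * (x + 1))\<^sup>2"
    unfolding power_mult_distrib power2_commute[of 1 x] by (simp add: distrib_left)
  hence "1 - x \<le> r * (x + 1)"
    by (rule power2_le_imp_le) (use r x in auto)
  hence "1 - r \<le> x * (1 + r)" by (simp add: algebra_simps)
  hence "(1 - r) / (1 + r) \<le> x" using r by (simp add: pos_divide_le_eq)
  thus ?thesis by (simp add: r_def x_def)
qed

section \<open>Derivatives along rays; uniqueness of the harmonic decomposition\<close>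

lemma has_real_derivative_Re_ray:
  assumes "(F has_field_derivative D) (at (of_real t * e))"
  shows "((\<lambda>t. Re (c * F (of_real t * e))) has_real_derivative Re (c * (D * e))) (at t)"
proof -
  have "((\<lambda>t. of_real t * e) has_vector_derivative e) (at t)"
    by (auto intro!: derivative_eq_intros)
  from field_vector_diff_chain_at[OF this assms]
  have "((\<lambda>t. F (of_real t * e)) has_vector_derivative D * e) (at t)"
    by (simp add: o_def mult.commute)
  hence "((\<lambda>t. c * F (of_real t * e)) has_vector_derivative c * (D * e)) (at t)"
    by (rule has_vector_derivative_mult_right)
  from bounded_linear.has_vector_derivative[OF bounded_linear_Re this]
  show ?thesis by (simp add: has_real_derivative_iff_has_vector_derivative)
qed

text \<open>The derivative is both complex linear and conjugate linear, so it vanishes. Comparing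
  its values at 1 and \<i> shows this.\<close>

lemma holomorphic_eq_cnj_imp_const:
  assumes H: "H holomorphic_on ball 0 1" and G: "G holomorphic_on ball 0 1"
    and eq: "\<And>z. z \<in> ball 0 1 \<Longrightarrow> H z = cnj (G z)" and z: "z \<in> ball 0 1"
  shows "H z = H 0"
proof -
  have "(H has_field_derivative 0) (at w)" if w: "w \<in> ball 0 1" for w
  proof -
    have dH: "(H has_field_derivative deriv H w) (at w)"
      using holomorphic_derivI[OF H open_ball w] .
    have dG: "(G has_field_derivative deriv G w) (at w)"
      using holomorphic_derivI[OF G open_ball w] .
    have "((\<lambda>z. cnj (G z)) has_derivative (\<lambda>v. cnj (deriv G w * v))) (at w)"
      using bounded_linear.has_derivative[OF bounded_linear_cnj dG[unfolded has_field_derivative_def]] .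
    hence "(H has_derivative (\<lambda>v. cnj (deriv G w * v))) (at w)"
      by (rule has_derivative_transform_within_open[OF _ open_ball w]) (simp add: eq)
    hence E: "(*) (deriv H w) = (\<lambda>v. cnj (deriv G w * v))"
      by (rule has_derivative_unique[OF dH[unfolded has_field_derivative_def]])
    have "deriv H w = cnj (deriv G w)" "deriv H w * \<i> = - cnj (deriv G w) * \<i>"
      using fun_cong[OF E, of 1] fun_cong[OF E, of \<i>] by simp_all
    hence "deriv H w = 0" by simp
    thus ?thesis using dH by simp
  qed
  hence "\<exists>c. \<forall>w\<in>ball 0 1. H w = c"
    by (intro has_field_derivative_zero_constant) (auto intro: has_field_derivative_at_within)
  thus ?thesis using z by force
qed

section \<open>Coefficient and growth bounds for a fixed pair \<open>h\<close>,
  \<open>g\<close>\<close>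

locale P0H_parts =
  fixes M :: real and h g :: "complex \<Rightarrow> complex"
  assumes M: "M > 0" and h: "h holomorphic_on ball 0 1" and g: "g holomorphic_on ball 0 1"
    and h0: "h 0 = 0" and h'0: "deriv h 0 = 1" and g0: "g 0 = 0" and g'0: "deriv g 0 = 0"
    and cond: "\<And>z. z \<in> ball 0 1 \<Longrightarrow>
      Re (z * deriv (deriv h) z) > - M + cmod (z * deriv (deriv g) z)"
begin

text \<open>The free unimodular \<open>\<epsilon>\<close> exploits the modulus of z g'' in the class
  condition: it can be adapted to a coefficient or to a ray. Writing \<open>of_real (1 / M)\<close>
  as a factor matches an \<open>fps_const\<close> in the expansion.\<close>

definition carath :: "complex \<Rightarrow> complex \<Rightarrow> complex" where
  "carath \<epsilon> z = 1 + of_real (1 / M) * (z * (deriv (deriv h) z + \<epsilon> * deriv (deriv g) z))"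

lemma holomorphic_carath: "carath \<epsilon> holomorphic_on ball 0 1"
  unfolding carath_def by (intro holomorphic_intros h g holomorphic_deriv) auto

lemma carath_0 [simp]: "carath \<epsilon> 0 = 1"
  by (simp add: carath_def)

lemma Re_carath:
  "Re (carath \<epsilon> z) = 1 + Re (z * (deriv (deriv h) z + \<epsilon> * deriv (deriv g) z)) / M"
  unfolding carath_def by (simp del: of_real_divide)

lemma Re_carath_pos:
  assumes "cmod \<epsilon> = 1" "z \<in> ball 0 1"
  shows "Re (carath \<epsilon> z) > 0"
proof -
  have "\<bar>Re (\<epsilon> * (z * deriv (deriv g) z))\<bar> \<le> cmod (z * deriv (deriv g) z)"
    using abs_Re_le_cmod[of "\<epsilon> * (z * deriv (deriv g) z)"] assms by (simp add: norm_mult)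
  hence "Re (z * deriv (deriv h) z) + Re (\<epsilon> * (z * deriv (deriv g) z)) > - M"
    using cond[OF assms(2)] by linarith
  hence "Re (z * (deriv (deriv h) z + \<epsilon> * deriv (deriv g) z)) > - M"
    by (simp add: distrib_left mult.left_commute del: times_complex.sel)
  thus ?thesis using M by (simp add: Re_carath field_simps)
qed

text \<open>The coefficient of z^(n-1) in \<open>carath \<epsilon>\<close> is n (n - 1) (a_n +
  \<epsilon> b_n) / M, and a suitable \<open>\<epsilon>\<close> makes |a_n + \<epsilon> b_n| = |a_n|
  + |b_n|.\<close>

lemma coeff_bound:
  assumes A: "h has_fps_expansion A" and B: "g has_fps_expansion B" and n: "n \<ge> 2"
  shows "cmod (fps_nth A n) + cmod (fps_nth B n) \<le> 2 * M / (real n * (real n - 1))"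
proof -
  obtain k where k: "n = Suc (Suc k)" using n by (metis add_2_eq_Suc le_Suc_ex)
  define a b where "a = fps_nth A n" and "b = fps_nth B n"
  \<comment> \<open>\<open>sgn a / sgn b\<close> turns \<open>b\<close> into the direction of
    \<open>a\<close>; if one of them is 0, any unit number works.\<close>
  obtain \<epsilon> where \<epsilon>: "cmod \<epsilon> = 1" "cmod (a + \<epsilon> * b) = cmod a + cmod b"
  proof (cases "a = 0 \<or> b = 0")
    case True
    thus ?thesis using that[of 1] by auto
  next
    case False
    have "cmod (a + (sgn a / sgn b) * b) = cmod (sgn a * of_real (cmod a + cmod b))"
      using False by (simp add: sgn_eq field_simps)
    also have "\<dots> = cmod a + cmod b"
      using False by (simp add: norm_mult norm_sgn flip: of_real_add)
    finally show ?thesis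
      using that[of "sgn a / sgn b"] False by (simp add: norm_divide norm_sgn)
  qed
  have "carath \<epsilon> has_fps_expansion 1 + fps_const (of_real (1 / M)) *
          (fps_X * (fps_deriv (fps_deriv A) + fps_const \<epsilon> * fps_deriv (fps_deriv B)))"
    unfolding carath_def by (intro fps_expansion_intros A B)
  from fps_nth_fps_expansion[OF this, of "Suc k"]
  have "(deriv ^^ Suc k) (carath \<epsilon>) 0 / fact (Suc k) =
      of_real (1 / M) * (of_nat (Suc (Suc k)) * of_nat (Suc k) * (a + \<epsilon> * b))"
    unfolding a_def b_def k by (simp add: algebra_simps)
  moreover have "cmod ((deriv ^^ Suc k) (carath \<epsilon>) 0 / fact (Suc k)) \<le> 2"
    by (rule caratheodory_coeff_bound)
      (use Re_carath_pos[OF \<epsilon>(1)] holomorphic_carath in \<open>auto simp: less_imp_le\<close>)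
  ultimately have "(1 / M) * (real (Suc (Suc k)) * real (Suc k) * (cmod a + cmod b)) \<le> 2"
    using M by (simp add: norm_mult norm_divide \<epsilon> del: of_nat_Suc)
  moreover have "real n = real (Suc (Suc k))" "real n - 1 = real (Suc k)"
    unfolding k by simp_all
  moreover have "real (Suc (Suc k)) * real (Suc k) > 0" by simp
  ultimately show ?thesis
    using M unfolding a_def[symmetric] b_def[symmetric] by (simp add: field_simps)
qed

text \<open>
  For a unit number \<open>e\<close>, \<open>Re (cnj e * cnj w) = Re (cnj e * (e\<^sup>2 * w))\<close>: along the ray through \<open>e\<close>
  the mapping \<open>h + cnj g\<close> can be replaced by the analytic function \<open>h + e\<^sup>2 g\<close>.
\<close>

lemma growth_lower:
  assumes z: "cmod z < 1"
  shows "cmod (h z + cnj (g z)) \<ge>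
    cmod z + 2 * M * (cmod z - (1 + cmod z) * ln (1 + cmod z))"
proof -
  define r where "r = cmod z"
  \<comment> \<open>At 0 \<open>sgn\<close> is 0, not a unit number, so 1 serves as the direction
    there.\<close>
  obtain e where e: "cmod e = 1" "z = of_real r * e"
  proof (cases "z = 0")
    case True
    thus ?thesis using that[of 1] by (simp add: r_def)
  next
    case False
    thus ?thesis using that[of "sgn z"] by (simp add: r_def norm_sgn) (simp add: sgn_eq)
  qed
  define F where "F w = h w + e\<^sup>2 * g w" for w
  define F' where "F' w = deriv h w + e\<^sup>2 * deriv g w" for w
  define F'' where "F'' w = deriv (deriv h) w + e\<^sup>2 * deriv (deriv g) w" for w
  have r: "0 \<le> r" "r < 1" using z by (auto simp: r_def)
  have ee: "cnj e * e = 1"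
    using complex_norm_square[of e] e by (simp add: mult.commute)
  have dF: "(F has_field_derivative F' w) (at w)" and dF': "(F' has_field_derivative F'' w) (at w)"
    if "cmod w < 1" for w
    unfolding F_def F'_def F''_def using that
    by (auto intro!: derivative_eq_intros holomorphic_derivI[OF _ open_ball]
        h g holomorphic_deriv simp: dist_norm)
  have inball: "cmod (of_real t * e) < 1" if "0 \<le> t" "t \<le> r" for t
    using that r e by (simp add: norm_mult)
  define u where "u t = Re (cnj e * F (of_real t * e))" for t
  define u' where "u' t = Re (1 * F' (of_real t * e))" for t
  \<comment> \<open>The claimed minorant. It agrees with \<open>u\<close> to first order at 0, so it
    suffices to compare second derivatives and integrate twice.\<close>
  define v where "v t = t + 2 * M * (t - (1 + t) * ln (1 + t))" for t
  define v' where "v' t = 1 - 2 * M * ln (1 + t)" for t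
  have du: "(u has_real_derivative u' t) (at t)" if "0 \<le> t" "t \<le> r" for t
    using has_real_derivative_Re_ray[OF dF[OF inball[OF that]], of "cnj e"] ee
    unfolding u_def u'_def by (simp add: mult.left_commute[of "cnj e"])
  have du': "(u' has_real_derivative Re (F'' (of_real t * e) * e)) (at t)" if "0 \<le> t" "t \<le> r" for t
    using has_real_derivative_Re_ray[OF dF'[OF inball[OF that]], of 1]
    unfolding u'_def by simp
  have dv: "(v has_real_derivative v' t) (at t)" if "0 \<le> t" for t
    unfolding v_def v'_def using that
    by (auto intro!: derivative_eq_intros)
  have dv': "(v' has_real_derivative - 2 * M / (1 + t)) (at t)" if "0 \<le> t" for t
    unfolding v'_def using that by (auto intro!: derivative_eq_intros)
  \<comment> \<open>The Caratheodory estimate for \<open>carath (e\<^sup>2)\<close> bounds t times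
    this quantity; dividing by \<open>t\<close> requires \<open>t > 0\<close>.\<close>
  have second: "Re (F'' (of_real t * e) * e) \<ge> - 2 * M / (1 + t)" if t: "0 < t" "t \<le> r" for t
  proof -
    have nt: "cmod (of_real t * e) = t" using t e by (simp add: norm_mult)
    have t1: "t < 1" using t r by simp
    have e2: "cmod (e\<^sup>2) = 1" by (simp add: norm_power e)
    have "(1 - t) / (1 + t) \<le> Re (carath (e\<^sup>2) (of_real t * e))"
      using caratheodory_Re_ge[OF holomorphic_carath[of "e\<^sup>2"] _ Re_carath_pos[OF e2], of "of_real t * e"]
        nt t1 by simp
    also have "\<dots> = 1 + Re (of_real t * (F'' (of_real t * e) * e)) / M"
      unfolding Re_carath F''_def by (simp only: mult_ac)
    also have "\<dots> = 1 + t * Re (F'' (of_real t * e) * e) / M"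
      by simp
    finally have "(1 - t) / (1 + t) - 1 \<le> t * Re (F'' (of_real t * e) * e) / M" by simp
    moreover have "(1 - t) / (1 + t) - 1 = t * (- 2 / (1 + t))"
      using t by (simp add: field_simps)
    ultimately have "t * (- 2 / (1 + t)) \<le> t * (Re (F'' (of_real t * e) * e) / M)" by simp
    hence "- 2 / (1 + t) \<le> Re (F'' (of_real t * e) * e) / M"
      using t by (simp only: mult_le_cancel_left_pos)
    thus ?thesis using M t by (simp add: field_simps)
  qed
  have first: "u' t - v' t \<ge> 0" if t: "0 \<le> t" "t \<le> r" for t
  proof -
    have "u' 0 - v' 0 \<le> u' t - v' t"
    \<comment> \<open>The open variant needs the sign of the derivative only inside the interval,
      where \<open>second\<close> is available.\<close>
    proof (rule DERIV_nonneg_imp_increasing_open[OF t(1)])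
      fix s assume s: "0 < s" "s < t"
      have "((\<lambda>s. u' s - v' s) has_real_derivative
              Re (F'' (of_real s * e) * e) - - 2 * M / (1 + s)) (at s)"
        using s t by (intro DERIV_diff du' dv') auto
      moreover have "Re (F'' (of_real s * e) * e) - - 2 * M / (1 + s) \<ge> 0"
        using second[of s] s t by simp
      ultimately show "\<exists>y. ((\<lambda>s. u' s - v' s) has_real_derivative y) (at s) \<and> 0 \<le> y"
        by (intro exI conjI)
    next
      show "continuous_on {0..t} (\<lambda>s. u' s - v' s)"
      proof (rule DERIV_continuous_on)
        fix s assume "s \<in> {0..t}"
        thus "((\<lambda>s. u' s - v' s) has_real_derivative
              Re (F'' (of_real s * e) * e) - - 2 * M / (1 + s)) (at s within {0..t})"
          using t by (intro has_field_derivative_at_within[OF DERIV_diff] du' dv') auto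
      qed
    qed
    thus ?thesis by (simp add: u'_def v'_def F'_def h'0 g'0)
  qed
  have "u 0 - v 0 \<le> u r - v r"
  proof (rule DERIV_nonneg_imp_nondecreasing[OF r(1)])
    fix s assume s: "0 \<le> s" "s \<le> r"
    have "((\<lambda>s. u s - v s) has_real_derivative u' s - v' s) (at s)"
      using s by (intro DERIV_diff du dv) auto
    thus "\<exists>y. ((\<lambda>s. u s - v s) has_real_derivative y) (at s) \<and> 0 \<le> y"
      using first[OF s] by (intro exI conjI)
  qed
  hence "v r \<le> u r" by (simp add: u_def v_def F_def h0 g0)
  also have "u r = Re (cnj e * (h z + cnj (g z)))"
  proof -
    have "u r = Re (cnj e * h z) + Re (cnj e * e * (e * g z))"
      unfolding u_def F_def e(2)[symmetric] by (simp add: algebra_simps power2_eq_square)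
    also have "Re (cnj e * e * (e * g z)) = Re (cnj e * cnj (g z))"
      unfolding ee by simp
    finally show ?thesis by (simp add: distrib_left)
  qed
  also have "\<dots> \<le> cmod (h z + cnj (g z))"
    using complex_Re_le_cmod[of "cnj e * (h z + cnj (g z))"] e by (simp add: norm_mult)
  finally show ?thesis by (simp add: v_def r_def)
qed

end

section \<open>The series of z^n / (n (n - 1)) and its tails\<close>

text \<open>Since 1 / (n (n - 1)) = 1 / (n - 1) - 1 / n, the series is a difference of two shifted
  logarithmic series. Division by zero being 0, the terms at n = 0 and n = 1 vanish.\<close>

lemma sums_log_series_complex:
  assumes "cmod z < 1"
  shows "(\<lambda>n. z ^ n / (of_nat n * (of_nat n - 1))) sums (z + (1 - z) * Ln (1 - z))"
proof -
  have L: "(\<lambda>n. z ^ n / of_nat n) sums - Ln (1 - z)"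
    using sums_minus[OF Ln_series'[of "- z"]] assms by simp
  have L1: "(\<lambda>n. z ^ Suc n / of_nat (Suc n)) sums - Ln (1 - z)"
    using L by (subst sums_Suc_iff) simp
  have L2: "(\<lambda>n. z ^ Suc (Suc n) / of_nat (Suc (Suc n))) sums (- Ln (1 - z) - z)"
    using L1 by (subst sums_Suc_iff) simp
  \<comment> \<open>With m = n + 2 the terms are z^m / (m - 1) - z^m / m.\<close>
  have "(\<lambda>n. z * (z ^ Suc n / of_nat (Suc n)) - z ^ Suc (Suc n) / of_nat (Suc (Suc n)))
          sums (z * - Ln (1 - z) - (- Ln (1 - z) - z))"
    by (intro sums_diff sums_mult L1 L2)
  moreover have "z * (z ^ Suc n / of_nat (Suc n)) - z ^ Suc (Suc n) / of_nat (Suc (Suc n)) =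
      z ^ Suc (Suc n) / (of_nat (Suc (Suc n)) * (of_nat (Suc (Suc n)) - 1))" for n
  proof -
    have "(1 + of_nat n :: complex) \<noteq> 0" "(2 + of_nat n :: complex) \<noteq> 0"
      by (metis of_nat_Suc of_nat_eq_0_iff nat.distinct(1))
         (metis of_nat_Suc of_nat_eq_0_iff nat.distinct(1) add.assoc one_add_one)
    thus ?thesis by (simp add: divide_simps) (simp add: algebra_simps)
  qed
  ultimately have "(\<lambda>n. z ^ Suc (Suc n) / (of_nat (Suc (Suc n)) * (of_nat (Suc (Suc n)) - 1)))
      sums (z + (1 - z) * Ln (1 - z))"
    by (simp add: algebra_simps)
  hence "(\<lambda>n. z ^ Suc n / (of_nat (Suc n) * (of_nat (Suc n) - 1))) sums (z + (1 - z) * Ln (1 - z))"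
    by (subst (asm) sums_Suc_iff) simp
  thus ?thesis
    by (subst (asm) sums_Suc_iff) simp
qed

lemma sums_log_series_real:
  fixes r :: real
  assumes "\<bar>r\<bar> < 1"
  shows "(\<lambda>n. r ^ n / (real n * (real n - 1))) sums (r + (1 - r) * ln (1 - r))"
proof -
  have "Ln (1 - of_real r) = of_real (ln (1 - r))"
    using assms Ln_of_real[of "1 - r"] by simp
  hence "(\<lambda>n. complex_of_real (r ^ n / (real n * (real n - 1))))
      sums of_real (r + (1 - r) * ln (1 - r))"
    using sums_log_series_complex[of "of_real r"] assms by simp
  thus ?thesis by (simp only: sums_of_real_iff)
qed

text \<open>Serves both estimates: \<open>2 * M * log_tail N r\<close> bounds the coefficient tail,
  and \<open>r + 2 * M * log_tail 2 r\<close> bounds |f|.\<close>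

definition log_tail :: "nat \<Rightarrow> real \<Rightarrow> real" where
  "log_tail N r = (\<Sum>n. r ^ (n + N) / (real (n + N) * (real (n + N) - 1)))"

lemma summable_log_tail:
  fixes r :: real
  assumes "\<bar>r\<bar> < 1"
  shows "summable (\<lambda>n. r ^ (n + N) / (real (n + N) * (real (n + N) - 1)))"
  using sums_summable[OF sums_log_series_real[OF assms]] by (rule summable_ignore_initial_segment)

lemma log_tail_eq:
  assumes "\<bar>r\<bar> < 1" "N \<ge> 2"
  shows "log_tail N r =
    r + (1 - r) * ln (1 - r) - (\<Sum>n = 2..<N. r ^ n / (real n * (real n - 1)))"
proof -
  have "log_tail N r = r + (1 - r) * ln (1 - r) - (\<Sum>n<N. r ^ n / (real n * (real n - 1)))"
    unfolding log_tail_def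
    using sums_unique[OF sums_split_initial_segment[OF sums_log_series_real[OF assms(1)], of N]] by simp
  also have "(\<Sum>n<N. r ^ n / (real n * (real n - 1))) = (\<Sum>n = 2..<N. r ^ n / (real n * (real n - 1)))"
  proof (rule sum.mono_neutral_right)
    show "\<forall>n\<in>{..<N} - {2..<N}. r ^ n / (real n * (real n - 1)) = 0"
    proof
      fix n assume "n \<in> {..<N} - {2..<N}"
      hence "n = 0 \<or> n = 1" by auto
      thus "r ^ n / (real n * (real n - 1)) = 0" by auto
    qed
  qed auto
  finally show ?thesis .
qed

lemma log_tail_mono:
  assumes "0 \<le> r" "r \<le> s" "s < 1"
  shows "log_tail N r \<le> log_tail N s"
  unfolding log_tail_def
proof (rule suminf_le)
  fix n
  \<comment> \<open>At index 0 the second factor is -1, but the product is 0.\<close>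
  have "real (n + N) * (real (n + N) - 1) \<ge> 0"
    by (cases "n + N") simp_all
  thus "r ^ (n + N) / (real (n + N) * (real (n + N) - 1)) \<le> s ^ (n + N) / (real (n + N) * (real (n + N) - 1))"
    using assms by (intro divide_right_mono power_mono) auto
qed (use assms in \<open>intro summable_log_tail; simp\<close>)+

lemma log_tail_nonneg:
  assumes "0 \<le> r" "r < 1" "N \<ge> 1"
  shows "log_tail N r \<ge> 0"
proof -
  have "log_tail N 0 = 0" using assms(3) by (simp add: log_tail_def power_0_left)
  thus ?thesis using log_tail_mono[of 0 r N] assms by simp
qed

section \<open>Monotonicity and roots of the Bohr equation\<close>

text \<open>Exhibits the equation as squared growth bound plus tail bound minus distance bound, the
  form in which the analytic estimates are compared with it.\<close>

lemma bohr_eq_lhs_tail: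
  assumes "\<bar>r\<bar> < 1" "N \<ge> 2"
  shows "bohr_eq_lhs M N r =
    (r + 2 * M * log_tail 2 r)\<^sup>2 + 2 * M * log_tail N r - (1 + 2 * M * (1 - ln 4))"
  using assms by (simp add: bohr_eq_lhs_def log_tail_eq algebra_simps)

text \<open>Strictness comes from the bare \<open>r\<close> inside the square; the tails are only
  known to be weakly monotone here. Allowing \<open>r = 0\<close> covers the centre of the
  disc.\<close>

lemma bohr_eq_lhs_strict_mono:
  assumes "M > 0" "N \<ge> 2" "0 \<le> r" "r < s" "s < 1"
  shows "bohr_eq_lhs M N r < bohr_eq_lhs M N s"
proof -
  have "log_tail 2 r \<ge> 0" "log_tail 2 r \<le> log_tail 2 s" "log_tail N r \<le> log_tail N s"
    using assms by (auto intro: log_tail_nonneg log_tail_mono)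
  hence "0 \<le> r + 2 * M * log_tail 2 r" "r + 2 * M * log_tail 2 r < s + 2 * M * log_tail 2 s"
    and tail: "2 * M * log_tail N r \<le> 2 * M * log_tail N s"
    using assms by (auto intro!: add_less_le_mono mult_left_mono)
  hence "(r + 2 * M * log_tail 2 r)\<^sup>2 < (s + 2 * M * log_tail 2 s)\<^sup>2"
    by (intro power_strict_mono) auto
  hence "(r + 2 * M * log_tail 2 r)\<^sup>2 + 2 * M * log_tail N r <
      (s + 2 * M * log_tail 2 s)\<^sup>2 + 2 * M * log_tail N s"
    using tail by (rule add_less_le_mono)
  thus ?thesis
    using assms by (simp add: bohr_eq_lhs_tail)
qed

lemma sum_inverse_consecutive:
  assumes "N \<ge> 2"
  shows "(\<Sum>n = 2..<N. 1 / (real n * (real n - 1))) = 1 - 1 / (real N - 1)"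
  using assms
proof (induction N rule: dec_induct)
  case (step n)
  hence "(\<Sum>k = 2..<Suc n. 1 / (real k * (real k - 1))) =
      1 - 1 / (real n - 1) + 1 / (real n * (real n - 1))"
    by simp
  also have "\<dots> = 1 - 1 / (real (Suc n) - 1)"
    using step by (simp add: divide_simps) (simp add: algebra_simps)
  finally show ?case .
qed simp

text \<open>At 0 the value is 2M (ln 4 - 1) - 1, negative by assumption; the limit at 1 is positive.
  The intermediate value theorem gives a root, and strict monotonicity makes it the
  smallest.\<close>

lemma bohr_eq_lhs_root_exists:
  assumes "M > 0" "N \<ge> 2" "2 * M * (ln 4 - 1) < 1"
  shows "\<exists>r. smallest_root_01 (bohr_eq_lhs M N) r"
proof -
  let ?s = "\<Sum>n = 2..<N. 1 / (real n * (real n - 1))"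
  have "((\<lambda>x::real. x * ln x) \<longlongrightarrow> 0) (at_right 0)"
    by real_asymp
  hence *: "((\<lambda>r::real. (1 - r) * ln (1 - r)) \<longlongrightarrow> 0) (at_left 1)"
    by (rule filterlim_compose) real_asymp
  have "((\<lambda>r. bohr_eq_lhs M N r) \<longlongrightarrow>
      (1 + 2 * M * (1 + 0))\<^sup>2 - 1 + 2 * M * (1 - 1 + 0 - (\<Sum>n = 2..<N. 1 ^ n / (real n * (real n - 1))) + ln 4))
      (at_left 1)"
    unfolding bohr_eq_lhs_def by (intro tendsto_intros *) auto
  moreover have "(1 + 2 * M * (1 + 0))\<^sup>2 - 1 + 2 * M * (1 - 1 + 0 - (\<Sum>n = 2..<N. 1 ^ n / (real n * (real n - 1))) + ln 4) > 0"
  proof -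
    \<comment> \<open>The telescoped sum keeps the limit (2M)^2 + 2M (2 + ln 4 - s) positive for
      every \<open>N\<close>.\<close>
    have "?s \<le> 1" using assms(2) by (simp add: sum_inverse_consecutive)
    moreover have "ln (4::real) > 0" by simp
    ultimately have "2 + ln 4 - ?s > 0" by linarith
    hence "2 * M * (2 + ln 4 - ?s) > 0" using assms(1) by (intro mult_pos_pos) auto
    hence "(2 * M)\<^sup>2 + 2 * M * (2 + ln 4 - ?s) > 0"
      by (intro add_nonneg_pos) auto
    thus ?thesis by (simp add: power2_eq_square algebra_simps)
  qed
  ultimately have "eventually (\<lambda>r. bohr_eq_lhs M N r > 0) (at_left 1)"
    by (rule order_tendstoD)
  with eventually_at_left_real[OF zero_less_one] have "eventually (\<lambda>r. bohr_eq_lhs M N r > 0 \<and> r \<in> {0<..<1}) (at_left 1)"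
    by eventually_elim auto
  then obtain R where R: "bohr_eq_lhs M N R > 0" "0 < R" "R < 1"
    using eventually_happens'[of "at_left (1::real)"] by fastforce
  have neg: "bohr_eq_lhs M N 0 < 0"
  proof -
    have "(\<Sum>n = 2..<N. 0 ^ n / (real n * (real n - 1))) = 0"
      by (intro sum.neutral) (auto simp: power_0_left)
    thus ?thesis using assms(3) by (simp add: bohr_eq_lhs_def algebra_simps)
  qed
  have "continuous_on {0..R} (bohr_eq_lhs M N)"
    unfolding bohr_eq_lhs_def using R by (intro continuous_intros) auto
  then obtain r where r: "0 \<le> r" "r \<le> R" "bohr_eq_lhs M N r = 0"
    using IVT'[of "bohr_eq_lhs M N" 0 0 R] R neg by auto
  have "r \<noteq> 0" using r neg by auto
  hence "r \<in> {0<..<1}" using r R by auto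
  moreover have "r \<le> s" if "s \<in> {0<..<1}" "bohr_eq_lhs M N s = 0" for s
    using bohr_eq_lhs_strict_mono[OF assms(1,2), of s r] that r R by fastforce
  ultimately show ?thesis
    using r(3) unfolding smallest_root_01_def by blast
qed

section \<open>From expansions of f to Taylor series of its parts\<close>

text \<open>The sequences \<open>a\<close>, \<open>b\<close> are tied only to \<open>f\<close>. The
  sums \<open>h1\<close>, \<open>g1\<close> of their series satisfy h - h1 = cnj (g1 - g), so this
  difference is constant, and it vanishes at 0.\<close>

lemma harmonic_expansion_partsE:
  assumes dec: "harmonic_decomp f h g" and ex: "harmonic_expansion f a b"
  obtains A B where "h has_fps_expansion A" "g has_fps_expansion B"
    "\<And>n. n \<ge> 2 \<Longrightarrow> fps_nth A n = a n" "\<And>n. n \<ge> 2 \<Longrightarrow> fps_nth B n = b n"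
proof -
  \<comment> \<open>The values of \<open>a\<close> and \<open>b\<close> at 0 and 1 are arbitrary, so
    the normalised coefficients replace them.\<close>
  define A where "A = Abs_fps (\<lambda>n. if n = 0 then 0 else if n = 1 then 1 else a n)"
  define B where "B = Abs_fps (\<lambda>n. if n < 2 then 0 else b n)"
  define h1 where "h1 z = z + (\<Sum>n. a (n + 2) * z ^ (n + 2))" for z
  define g1 where "g1 z = (\<Sum>n. b (n + 2) * z ^ (n + 2))" for z
  have sA: "(\<lambda>n. fps_nth A n * z ^ n) sums h1 z" and sB: "(\<lambda>n. fps_nth B n * z ^ n) sums g1 z"
    if z: "z \<in> ball 0 1" for z
  proof -
    have "summable (\<lambda>n. a (n + 2) * z ^ (n + 2))" "summable (\<lambda>n. b (n + 2) * z ^ (n + 2))"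
      using ex z by (auto simp: harmonic_expansion_def)
    hence "(\<lambda>n. fps_nth A (n + 2) * z ^ (n + 2)) sums (h1 z - (\<Sum>i<2. fps_nth A i * z ^ i))"
      "(\<lambda>n. fps_nth B (n + 2) * z ^ (n + 2)) sums (g1 z - (\<Sum>i<2. fps_nth B i * z ^ i))"
      by (simp_all add: A_def B_def h1_def g1_def summable_sums numeral_2_eq_2)
    thus "(\<lambda>n. fps_nth A n * z ^ n) sums h1 z" "(\<lambda>n. fps_nth B n * z ^ n) sums g1 z"
        using sums_iff_shift'[of "\<lambda>n. fps_nth A n * z ^ n" 2 "h1 z"]
        sums_iff_shift'[of "\<lambda>n. fps_nth B n * z ^ n" 2 "g1 z"] by blast+
  qed
  have h1: "h1 holomorphic_on ball 0 1" and g1: "g1 holomorphic_on ball 0 1"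
    using sA sB by (auto intro!: power_series_holomorphic)
  have h: "h holomorphic_on ball 0 1" and g: "g holomorphic_on ball 0 1"
    and f: "\<And>z. z \<in> ball 0 1 \<Longrightarrow> f z = h z + cnj (g z)" and h0: "h 0 = 0" "g 0 = 0"
    using dec by (auto simp: harmonic_decomp_def)
  have f1: "f z = h1 z + cnj (g1 z)" if "z \<in> ball 0 1" for z
    using ex that by (auto simp: harmonic_expansion_def h1_def g1_def)
  have eq: "h z = h1 z \<and> g z = g1 z" if z: "z \<in> ball 0 1" for z
  proof -
    have "h z - h1 z = h 0 - h1 0"
    proof (rule holomorphic_eq_cnj_imp_const[OF _ _ _ z])
      show "(\<lambda>z. h z - h1 z) holomorphic_on ball 0 1" "(\<lambda>z. g1 z - g z) holomorphic_on ball 0 1"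
        by (intro holomorphic_intros h h1 g g1)+
      show "h z - h1 z = cnj (g1 z - g z)" if "z \<in> ball 0 1" for z
        using f[OF that] f1[OF that] by (simp add: algebra_simps)
    qed
    moreover have "h1 0 = 0" by (simp add: h1_def)
    ultimately have "h z = h1 z" using h0 by simp
    thus ?thesis using f[OF z] f1[OF z] by simp
  qed
  have rad: "fps_conv_radius P > 0" if "\<And>z. z \<in> ball 0 1 \<Longrightarrow> (\<lambda>n. fps_nth P n * z ^ n) sums (k z)"
    for P and k :: "complex \<Rightarrow> complex"
  proof -
    \<comment> \<open>Convergence at a single nonzero point suffices; 1/2 is an arbitrary choice in
      the disc.\<close>
    have "ereal (cmod (1 / 2)) \<le> fps_conv_radius P"
      unfolding fps_conv_radius_def
      by (rule conv_radius_geI, rule sums_summable, rule that) (simp add: norm_divide)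
    thus ?thesis by (rule less_le_trans[rotated]) (simp add: norm_divide)
  qed
  have near: "eventually (\<lambda>z::complex. z \<in> ball 0 1) (nhds 0)"
    by (intro eventually_nhds_in_open) auto
  have "h has_fps_expansion A"
    unfolding has_fps_expansion_def using near
    by (auto intro: rad sA elim!: eventually_mono simp: eq eval_fps_def sums_unique[OF sA, symmetric])
  moreover have "g has_fps_expansion B"
    unfolding has_fps_expansion_def using near
    by (auto intro: rad sB elim!: eventually_mono simp: eq eval_fps_def sums_unique[OF sB, symmetric])
  ultimately show thesis
    by (rule that) (auto simp: A_def B_def)
qed

lemma P0H_expansion:
  assumes M: "M > 0" and f: "f \<in> class_P0H M" and ex: "harmonic_expansion f a b"
  shows P0H_coeff_bound: "n \<ge> 2 \<Longrightarrow> cmod (a n) + cmod (b n) \<le> 2 * M / (real n * (real n - 1))"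
    and P0H_growth_lower: "cmod z < 1 \<Longrightarrow>
          cmod z + 2 * M * (cmod z - (1 + cmod z) * ln (1 + cmod z)) \<le> cmod (f z)"
    and P0H_at_0: "f 0 = 0"
proof -
  obtain h g where dec: "harmonic_decomp f h g" and
    cond: "\<And>z. z \<in> ball 0 1 \<Longrightarrow> Re (z * deriv (deriv h) z) > - M + cmod (z * deriv (deriv g) z)"
    using f by (auto simp: class_P0H_def)
  interpret P0H_parts M h g
    using M dec cond by unfold_locales (auto simp: harmonic_decomp_def)
  have fhg: "\<And>z. z \<in> ball 0 1 \<Longrightarrow> f z = h z + cnj (g z)"
    using dec by (auto simp: harmonic_decomp_def)
  obtain A B where "h has_fps_expansion A" "g has_fps_expansion B"
    "\<And>n. n \<ge> 2 \<Longrightarrow> fps_nth A n = a n" "\<And>n. n \<ge> 2 \<Longrightarrow> fps_nth B n = b n"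
    using harmonic_expansion_partsE[OF dec ex] by metis
  thus "n \<ge> 2 \<Longrightarrow> cmod (a n) + cmod (b n) \<le> 2 * M / (real n * (real n - 1))"
    using coeff_bound by metis
  show "cmod z < 1 \<Longrightarrow>
          cmod z + 2 * M * (cmod z - (1 + cmod z) * ln (1 + cmod z)) \<le> cmod (f z)"
    using growth_lower[of z] fhg[of z] by simp
  show "f 0 = 0" using fhg[of 0] h0 g0 by simp
qed

section \<open>Estimates for the boundary distance\<close>

lemma boundary_dist_ge:
  assumes "\<And>z. cmod z < 1 \<Longrightarrow> \<phi> (cmod z) \<le> cmod (f z - f 0)"
    and lim: "(\<phi> \<longlongrightarrow> L) (at_left 1)"
  shows "boundary_dist f \<ge> ereal L"
  unfolding boundary_dist_def le_Liminf_iff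
proof (intro allI impI)
  fix y assume y: "y < ereal L"
  have "((\<lambda>r. ereal (\<phi> r)) \<longlongrightarrow> ereal L) (at_left 1)"
    using lim by simp
  hence "eventually (\<lambda>r. y < ereal (\<phi> r)) (at_left 1)"
    using y by (rule order_tendstoD)
  moreover have "eventually (\<lambda>r. r < 1) (at_left (1::real))"
    by (simp add: eventually_at_filter)
  ultimately have "eventually (\<lambda>r. y < ereal (\<phi> r) \<and> r < 1) (at_left 1)"
    by eventually_elim simp
  from eventually_filtercomapI[OF this, of cmod]
  show "eventually (\<lambda>z. y < ereal (cmod (f z - f 0))) (filtercomap cmod (at_left 1))"
  proof eventually_elim
    case (elim z)
    hence "ereal (\<phi> (cmod z)) \<le> ereal (cmod (f z - f 0))" using assms(1)[of z] by simp
    thus ?case using elim by (auto intro: less_le_trans)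
  qed
qed

text \<open>An event of the \<open>filtercomap\<close> filter contains all points with modulus close
  enough to 1, so it meets every curve that satisfies |\<gamma>(r)| = r.\<close>

lemma boundary_dist_le:
  assumes lim: "((\<lambda>r. cmod (f (\<gamma> r) - f 0)) \<longlongrightarrow> L) (at_left 1)"
    and \<gamma>: "\<And>r. 0 < r \<Longrightarrow> r < 1 \<Longrightarrow> cmod (\<gamma> r) = r"
  shows "boundary_dist f \<le> ereal L"
proof (rule ccontr)
  assume "\<not> boundary_dist f \<le> ereal L"
  then obtain y where y: "ereal L < y" "y < boundary_dist f"
    using dense[of "ereal L" "boundary_dist f"] by (auto simp: not_le)
  from less_LiminfD[OF y(2)[unfolded boundary_dist_def]]
  obtain Q where Q: "eventually Q (at_left 1)"
    "\<And>z. Q (cmod z) \<Longrightarrow> y < ereal (cmod (f z - f 0))"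
    unfolding eventually_filtercomap by blast
  have "((\<lambda>r. ereal (cmod (f (\<gamma> r) - f 0))) \<longlongrightarrow> ereal L) (at_left 1)"
    using lim by simp
  hence "eventually (\<lambda>r. ereal (cmod (f (\<gamma> r) - f 0)) < y) (at_left 1)"
    using y(1) by (rule order_tendstoD)
  with Q(1) eventually_at_left_real[OF zero_less_one] have "eventually (\<lambda>_. False) (at_left (1::real))"
  proof eventually_elim
    case (elim r)
    thus ?case using Q(2)[of "\<gamma> r"] \<gamma>[of r] by auto
  qed
  thus False by simp
qed

lemma growth_lower_limit:
  "((\<lambda>r. r + 2 * M * (r - (1 + r) * ln (1 + r))) \<longlongrightarrow> 1 + 2 * M * (1 - ln 4)) (at_left (1::real))"
proof -
  have "((\<lambda>r. r + 2 * M * (r - (1 + r) * ln (1 + r))) \<longlongrightarrow> 1 + 2 * M * (1 - (1 + 1) * ln (1 + 1))) (at_left (1::real))"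
    by (intro tendsto_intros) auto
  moreover have "ln (4::real) = 2 * ln 2"
    using ln_realpow[of 2 2] by simp
  ultimately show ?thesis by simp
qed

section \<open>The Bohr inequality up to the root\<close>

lemma P0H_boundary_dist_ge:
  assumes "M > 0" "f \<in> class_P0H M" "harmonic_expansion f a b"
  shows "boundary_dist f \<ge> ereal (1 + 2 * M * (1 - ln 4))"
  by (rule boundary_dist_ge[OF _ growth_lower_limit])
     (use P0H_growth_lower[OF assms] P0H_at_0[OF assms] in simp)

lemma P0H_tail_bound:
  assumes P: "M > 0" "f \<in> class_P0H M" "harmonic_expansion f a b" and "N \<ge> 2" and r: "0 \<le> r" "r < 1"
  shows P0H_tail_summable: "summable (\<lambda>n. (cmod (a (n + N)) + cmod (b (n + N))) * r ^ (n + N))"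
    and P0H_tail_le: "(\<Sum>n. (cmod (a (n + N)) + cmod (b (n + N))) * r ^ (n + N)) \<le> 2 * M * log_tail N r"
proof -
  have le: "(cmod (a (n + N)) + cmod (b (n + N))) * r ^ (n + N) \<le>
      2 * M * (r ^ (n + N) / (real (n + N) * (real (n + N) - 1)))" for n
    using mult_right_mono[OF P0H_coeff_bound[OF P, of "n + N"], of "r ^ (n + N)"] \<open>N \<ge> 2\<close> r by simp
  have s: "summable (\<lambda>n. 2 * M * (r ^ (n + N) / (real (n + N) * (real (n + N) - 1))))"
    using r by (intro summable_mult summable_log_tail) auto
  show s': "summable (\<lambda>n. (cmod (a (n + N)) + cmod (b (n + N))) * r ^ (n + N))"
    by (rule summable_comparison_test'[OF s]) (use le r in \<open>simp add: abs_mult\<close>)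
  have "(\<Sum>n. (cmod (a (n + N)) + cmod (b (n + N))) * r ^ (n + N)) \<le>
      (\<Sum>n. 2 * M * (r ^ (n + N) / (real (n + N) * (real (n + N) - 1))))"
    by (rule suminf_le[OF le s' s])
  also have "\<dots> = 2 * M * log_tail N r"
    unfolding log_tail_def using r by (intro suminf_mult summable_log_tail) auto
  finally show "(\<Sum>n. (cmod (a (n + N)) + cmod (b (n + N))) * r ^ (n + N)) \<le> 2 * M * log_tail N r" .
qed

text \<open>Triangle inequality on the series, followed by the coefficient tail bound for
  \<open>N = 2\<close>.\<close>

lemma P0H_growth_upper:
  assumes P: "M > 0" "f \<in> class_P0H M" "harmonic_expansion f a b" and z: "cmod z < 1"
  shows "cmod (f z) \<le> cmod z + 2 * M * log_tail 2 (cmod z)"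
proof -
  let ?c = "\<lambda>n. (cmod (a (n + 2)) + cmod (b (n + 2))) * cmod z ^ (n + 2)"
  have c: "summable ?c" using P0H_tail_summable[OF P, of 2 "cmod z"] z by simp
  have sa: "summable (\<lambda>n. cmod (a (n + 2) * z ^ (n + 2)))"
    by (rule summable_comparison_test'[OF c]) (simp add: norm_mult norm_power mult_right_mono)
  have sb: "summable (\<lambda>n. cmod (b (n + 2) * z ^ (n + 2)))"
    by (rule summable_comparison_test'[OF c]) (simp add: norm_mult norm_power mult_right_mono)
  have "f z = z + (\<Sum>n. a (n + 2) * z ^ (n + 2)) + cnj (\<Sum>n. b (n + 2) * z ^ (n + 2))"
    using P(3) z by (simp add: harmonic_expansion_def)
  also have "cmod \<dots> \<le> cmod z + cmod (\<Sum>n. a (n + 2) * z ^ (n + 2)) + cmod (cnj (\<Sum>n. b (n + 2) * z ^ (n + 2)))"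
    by (rule norm_triangle_le[OF add_right_mono[OF norm_triangle_ineq]])
  also have "cmod (cnj (\<Sum>n. b (n + 2) * z ^ (n + 2))) = cmod (\<Sum>n. b (n + 2) * z ^ (n + 2))"
    by (rule complex_mod_cnj)
  also have "cmod z + cmod (\<Sum>n. a (n + 2) * z ^ (n + 2)) + cmod (\<Sum>n. b (n + 2) * z ^ (n + 2))
      \<le> cmod z + (\<Sum>n. cmod (a (n + 2) * z ^ (n + 2))) + (\<Sum>n. cmod (b (n + 2) * z ^ (n + 2)))"
    by (intro add_mono summable_norm sa sb order_refl)
  also have "\<dots> = cmod z + (\<Sum>n. ?c n)"
    using suminf_add[OF sa sb] by (simp add: norm_mult norm_power distrib_right)
  also have "\<dots> \<le> cmod z + 2 * M * log_tail 2 (cmod z)"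
    using P0H_tail_le[OF P, of 2 "cmod z"] z by simp
  finally show ?thesis .
qed

lemma bohr_ineq_if_lhs_nonpos:
  assumes P: "M > 0" "f \<in> class_P0H M" "harmonic_expansion f a b" and N: "N \<ge> 2"
    and z: "cmod z < 1" and nonpos: "bohr_eq_lhs M N (cmod z) \<le> 0"
  shows "bohr_ineq N f a b z"
proof -
  have "(cmod (f z))\<^sup>2 \<le> (cmod z + 2 * M * log_tail 2 (cmod z))\<^sup>2"
    using P0H_growth_upper[OF P z] by (intro power_mono) auto
  moreover have "bohr_eq_lhs M N (cmod z) = (cmod z + 2 * M * log_tail 2 (cmod z))\<^sup>2
      + 2 * M * log_tail N (cmod z) - (1 + 2 * M * (1 - ln 4))"
    using z N by (intro bohr_eq_lhs_tail) auto
  ultimately have "(cmod (f z))\<^sup>2 + (\<Sum>n. (cmod (a (n + N)) + cmod (b (n + N))) * cmod z ^ (n + N))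
      \<le> 1 + 2 * M * (1 - ln 4)"
    using P0H_tail_le[OF P N, of "cmod z"] z nonpos by simp
  hence "ereal ((cmod (f z))\<^sup>2 + (\<Sum>n. (cmod (a (n + N)) + cmod (b (n + N))) * cmod z ^ (n + N)))
      \<le> ereal (1 + 2 * M * (1 - ln 4))"
    by simp
  also note P0H_boundary_dist_ge[OF P]
  finally show ?thesis unfolding bohr_ineq_def .
qed

section \<open>The extremal mapping and sharpness\<close>

text \<open>The solution with g = 0 and 1 + z h'' / M = (1 + z) / (1 - z), the half-plane map that
  is extremal for Caratheodory's inequalities.\<close>

definition extremal :: "real \<Rightarrow> complex \<Rightarrow> complex" where
  "extremal M z = z + of_real (2 * M) * (z + (1 - z) * Ln (1 - z))"

text \<open>Zero at indices 0 and 1 by the convention for division by zero, so summing from 0 or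
  from 2 is the same.\<close>

definition extremal_coeff :: "real \<Rightarrow> nat \<Rightarrow> complex" where
  "extremal_coeff M n = of_real (2 * M / (real n * (real n - 1)))"

lemma one_minus_notin_nonpos:
  assumes "cmod z < 1"
  shows "1 - z \<notin> \<real>\<^sub>\<le>\<^sub>0"
  using assms abs_Re_le_cmod[of z] by (auto simp: complex_nonpos_Reals_iff)

text \<open>M + z h'' = M (1 + z) / (1 - z) has real part M (1 - |z|^2) / |1 - z|^2 > 0.\<close>

lemma extremal_in_class:
  assumes "M > 0"
  shows "extremal M \<in> class_P0H M"
proof -
  have d1: "(extremal M has_field_derivative 1 - of_real (2 * M) * Ln (1 - z)) (at z)"
    if "cmod z < 1" for z
  proof -
    have "1 - z \<noteq> 0" using that by auto
    thus ?thesis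
      unfolding extremal_def using one_minus_notin_nonpos[OF that]
      by (auto intro!: derivative_eq_intros simp: divide_simps)
  qed
  have D1: "deriv (extremal M) z = 1 - of_real (2 * M) * Ln (1 - z)" if "cmod z < 1" for z
    using d1[OF that] by (rule DERIV_imp_deriv)
  have d2: "((\<lambda>z. 1 - of_real (2 * M) * Ln (1 - z)) has_field_derivative of_real (2 * M) / (1 - z)) (at z)"
    if "cmod z < 1" for z
    using one_minus_notin_nonpos[OF that] by (auto intro!: derivative_eq_intros simp: divide_inverse)
  have D2: "deriv (deriv (extremal M)) z = of_real (2 * M) / (1 - z)" if z: "cmod z < 1" for z
  proof -
    have "eventually (\<lambda>w. w \<in> ball 0 1) (nhds z)"
      using z by (intro eventually_nhds_in_open) auto
    hence "deriv (deriv (extremal M)) z = deriv (\<lambda>z. 1 - of_real (2 * M) * Ln (1 - z)) z"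
      by (intro deriv_cong_ev) (auto elim!: eventually_mono simp: D1)
    thus ?thesis using d2[OF z] DERIV_imp_deriv by metis
  qed
  have hol: "extremal M holomorphic_on ball 0 1"
    unfolding holomorphic_on_open[OF open_ball] using d1 by (metis mem_ball_0)
  have dec: "harmonic_decomp (extremal M) (extremal M) (\<lambda>_. 0)"
    unfolding harmonic_decomp_def
    using hol D1[of 0] by (simp add: extremal_def)
  have "Re (z * deriv (deriv (extremal M)) z) > - M" if z: "cmod z < 1" for z
  proof -
    have "1 - z \<noteq> 0" using z by auto
    hence pos: "cmod (1 - z) ^ 2 > 0" by simp
    have "z * (of_real (2 * M) / (1 - z)) + of_real M = of_real M * ((1 + z) / (1 - z))"
      using \<open>1 - z \<noteq> 0\<close> by (simp add: divide_simps) (simp add: algebra_simps)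
    hence "Re (z * (of_real (2 * M) / (1 - z))) + M = Re (of_real M * ((1 + z) / (1 - z)))"
      by (metis Re_complex_of_real plus_complex.sel(1))
    also have "\<dots> = M * (1 - (cmod z)\<^sup>2) / (cmod (1 - z))\<^sup>2"
      by (simp add: Re_divide cmod_power2) (simp add: power2_eq_square algebra_simps)
    also have "\<dots> > 0"
      using pos assms z by (intro divide_pos_pos mult_pos_pos) (auto simp: abs_square_less_1)
    finally show ?thesis using D2[OF z] by simp
  qed
  with dec show ?thesis
    unfolding class_P0H_def class_H0_def by fastforce
qed

lemma extremal_expansion: "harmonic_expansion (extremal M) (extremal_coeff M) (\<lambda>_. 0)"
  unfolding harmonic_expansion_def
proof (intro ballI conjI)
  fix z :: complex assume "z \<in> ball 0 1"
  hence z: "cmod z < 1" by simp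
  have "(\<lambda>n. of_real (2 * M) * (z ^ n / (of_nat n * (of_nat n - 1)))) sums
      (of_real (2 * M) * (z + (1 - z) * Ln (1 - z)))"
    by (intro sums_mult sums_log_series_complex z)
  hence "(\<lambda>n. extremal_coeff M n * z ^ n) sums (of_real (2 * M) * (z + (1 - z) * Ln (1 - z)))"
    by (simp add: extremal_coeff_def)
  from sums_split_initial_segment[OF this, of 2]
  have s: "(\<lambda>n. extremal_coeff M (n + 2) * z ^ (n + 2)) sums (of_real (2 * M) * (z + (1 - z) * Ln (1 - z)))"
    by (simp add: extremal_coeff_def numeral_2_eq_2)
  show "summable (\<lambda>n. extremal_coeff M (n + 2) * z ^ (n + 2))"
    using s by (rule sums_summable)
  show "summable (\<lambda>n. (0::complex) * z ^ (n + 2))" by simp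
  show "extremal M z = z + (\<Sum>n. extremal_coeff M (n + 2) * z ^ (n + 2)) + cnj (\<Sum>n. 0 * z ^ (n + 2))"
    using sums_unique[OF s] by (simp add: extremal_def)
qed

lemma extremal_of_real:
  assumes "r < 1"
  shows "extremal M (of_real r) = of_real (r + 2 * M * (r + (1 - r) * ln (1 - r)))"
  using assms Ln_of_real[of "1 - r"] by (simp add: extremal_def)

text \<open>At -r the mapping takes the negative of the lower growth bound. The modulus tends to the
  absolute value of the limit, whence the sign hypothesis.\<close>

lemma boundary_dist_extremal_le:
  assumes "1 + 2 * M * (1 - ln 4) \<ge> 0"
  shows "boundary_dist (extremal M) \<le> ereal (1 + 2 * M * (1 - ln 4))"
proof (rule boundary_dist_le)
  have "((\<lambda>r. \<bar>r + 2 * M * (r - (1 + r) * ln (1 + r))\<bar>) \<longlongrightarrow> \<bar>1 + 2 * M * (1 - ln 4)\<bar>) (at_left (1::real))"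
    by (intro tendsto_rabs growth_lower_limit)
  moreover have "eventually (\<lambda>r. \<bar>r + 2 * M * (r - (1 + r) * ln (1 + r))\<bar> =
      cmod (extremal M (of_real (- r)) - extremal M 0)) (at_left (1::real))"
    using eventually_at_left_real[OF zero_less_one]
  proof eventually_elim
    case (elim r)
    have "extremal M (of_real (- r)) = - of_real (r + 2 * M * (r - (1 + r) * ln (1 + r)))"
      using elim by (subst extremal_of_real) (auto simp: algebra_simps)
    moreover have "extremal M 0 = 0" by (simp add: extremal_def)
    ultimately show ?case by (simp only: diff_zero norm_minus_cancel norm_of_real)
  qed
  ultimately show "((\<lambda>r. cmod (extremal M (of_real (- r)) - extremal M 0)) \<longlongrightarrow> 1 + 2 * M * (1 - ln 4)) (at_left 1)"
    using assms by (simp add: tendsto_cong)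
qed simp

text \<open>On the positive radius the growth and tail bounds are equalities, so a positive
  \<open>bohr_eq_lhs\<close> puts the sum above the boundary distance.\<close>

lemma not_bohr_ineq_extremal:
  assumes "M > 0" "N \<ge> 2" "0 \<le> r" "r < 1" "1 + 2 * M * (1 - ln 4) \<ge> 0" "bohr_eq_lhs M N r > 0"
  shows "\<not> bohr_ineq N (extremal M) (extremal_coeff M) (\<lambda>_. 0) (of_real r)"
proof -
  have nonneg: "real (n + N) * (real (n + N) - 1) \<ge> 0" for n
    using assms(2) by simp
  have "(cmod (extremal_coeff M (n + N)) + cmod 0) * cmod (of_real r) ^ (n + N) =
      2 * M * (r ^ (n + N) / (real (n + N) * (real (n + N) - 1)))" for n
    using assms(1,3) nonneg[of n] by (simp only: extremal_coeff_def norm_of_real abs_divide norm_zero) simp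
  hence "(\<Sum>n. (cmod (extremal_coeff M (n + N)) + cmod 0) * cmod (of_real r) ^ (n + N)) =
      (\<Sum>n. 2 * M * (r ^ (n + N) / (real (n + N) * (real (n + N) - 1))))"
    by (rule suminf_cong)
  also have "\<dots> = 2 * M * log_tail N r"
    unfolding log_tail_def using assms(3,4) by (intro suminf_mult summable_log_tail) auto
  finally have tail: "(\<Sum>n. (cmod (extremal_coeff M (n + N)) + cmod 0) * cmod (of_real r) ^ (n + N)) =
      2 * M * log_tail N r" .
  have "cmod (extremal M (of_real r)) = \<bar>r + 2 * M * log_tail 2 r\<bar>"
    using assms(3,4) by (simp only: extremal_of_real norm_of_real) (simp add: log_tail_eq)
  hence "(cmod (extremal M (of_real r)))\<^sup>2 = (r + 2 * M * log_tail 2 r)\<^sup>2"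
    by simp
  hence "1 + 2 * M * (1 - ln 4) < (cmod (extremal M (of_real r)))\<^sup>2 + 2 * M * log_tail N r"
    using bohr_eq_lhs_tail[of r N M] assms by simp
  with boundary_dist_extremal_le[OF assms(5)]
  have "boundary_dist (extremal M) < ereal ((cmod (extremal M (of_real r)))\<^sup>2 + 2 * M * log_tail N r)"
    by (meson le_less_trans less_ereal.simps(1))
  thus ?thesis
    unfolding bohr_ineq_def tail by (simp add: not_le)
qed

text \<open>The condition \<open>2 * M * (ln 4 - 1) < 1\<close> says that the distance bound 1 + 2M
  (1 - ln 4) is positive, equivalently that the equation starts negative at 0. The inequality and
  its sharpness are stated for any given smallest root.\<close>

theorem theorem2p4:
  fixes M :: real and N :: nat
  assumes "M > 0" and "N \<ge> 2"
  shows "(2 * M * (ln 4 - 1) < 1 \<longrightarrow> (\<exists>rN. smallest_root_01 (bohr_eq_lhs M N) rN)) \<and>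
    (\<forall>rN. smallest_root_01 (bohr_eq_lhs M N) rN \<longrightarrow>
       (\<forall>f\<in>class_P0H M. \<forall>a b. harmonic_expansion f a b \<longrightarrow>
          (\<forall>z. cmod z \<le> rN \<longrightarrow> bohr_ineq N f a b z)) \<and>
       (\<forall>\<rho>>rN. \<exists>f\<in>class_P0H M. \<exists>a b. harmonic_expansion f a b \<and>
          (\<exists>z\<in>ball 0 1. cmod z \<le> \<rho> \<and> \<not> bohr_ineq N f a b z)))"
proof (intro conjI impI allI ballI)
  assume "2 * M * (ln 4 - 1) < 1"
  thus "\<exists>rN. smallest_root_01 (bohr_eq_lhs M N) rN"
    using assms by (intro bohr_eq_lhs_root_exists)
next
  fix rN f a b z
  assume "smallest_root_01 (bohr_eq_lhs M N) rN" and f: "f \<in> class_P0H M"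
    "harmonic_expansion f a b" and z: "cmod z \<le> rN"
  hence rN: "0 < rN" "rN < 1" "bohr_eq_lhs M N rN = 0"
    by (auto simp: smallest_root_01_def)
  have "bohr_eq_lhs M N (cmod z) \<le> 0"
    \<comment> \<open>Strict monotonicity leaves the case |z| = \<open>rN\<close> to the root
      equation.\<close>
    using bohr_eq_lhs_strict_mono[OF assms, of "cmod z" rN] rN z
    by (cases "cmod z = rN") auto
  thus "bohr_ineq N f a b z"
    using z rN assms f by (intro bohr_ineq_if_lhs_nonpos[of M]) auto
next
  fix rN \<rho> :: real
  assume "smallest_root_01 (bohr_eq_lhs M N) rN" and \<rho>: "rN < \<rho>"
  hence rN: "0 < rN" "rN < 1" "bohr_eq_lhs M N rN = 0"
    by (auto simp: smallest_root_01_def)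
  \<comment> \<open>The minimum with 1 keeps the counterexample point in the disc when
    \<open>\<rho>\<close> is large.\<close>
  obtain r where r: "rN < r" "r < 1" "r < \<rho>"
    using dense[of rN "min 1 \<rho>"] rN \<rho> by auto
  have pos: "bohr_eq_lhs M N r > 0"
    using bohr_eq_lhs_strict_mono[OF assms, of rN r] rN r by simp
  \<comment> \<open>At a root the distance bound equals a square plus this tail, so the existence of
    a root already makes it nonnegative.\<close>
  have "2 * M * log_tail N rN \<ge> 0"
    using assms rN log_tail_nonneg[of rN N] by simp
  hence "1 + 2 * M * (1 - ln 4) \<ge> 0"
    using rN assms(2) bohr_eq_lhs_tail[of rN N M] zero_le_power2[of "rN + 2 * M * log_tail 2 rN"]
    by linarith
  hence "\<not> bohr_ineq N (extremal M) (extremal_coeff M) (\<lambda>_. 0) (of_real r)"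
    using assms rN r pos by (intro not_bohr_ineq_extremal) auto
  moreover have "complex_of_real r \<in> ball 0 1" "cmod (of_real r) \<le> \<rho>"
    using rN r by auto
  ultimately show "\<exists>f\<in>class_P0H M. \<exists>a b. harmonic_expansion f a b \<and>
          (\<exists>z\<in>ball 0 1. cmod z \<le> \<rho> \<and> \<not> bohr_ineq N f a b z)"
    using extremal_in_class[OF assms(1)] extremal_expansion by blast
qed

end
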